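(* Let $p$ be a prime, $d\ge1$, $\ell$ a primitive divisor of $p^d-1$, and let $G=N{:}H\le\mathrm{AGL}(1,p^d)$ where $N\cong\mathbb{Z}_p^d$ is the translation subgroup and $H=\langle h\rangle\le\mathrm{GL}(1,p^d)$ has order $\ell$. Let $x_1,x_2\in N\setminus\{1\}$ and let $0\le i_1,i_2,j_1,j_2\le\ell-1$ with $\gcd(j_1,\ell)=\gcd(j_2,\ell)=1$. For $t=1,2$ put $b_t=h^{i_t}x_t$ and $w_t=x_t^{-1}h^{j_t-i_t}$. Then the following are equivalent: (i) $\mathcal{D}(G,b_1,w_1)\cong\mathcal{D}(G,b_2,w_2)$; (ii) there is $k$ with $0\le k\le d-1$ such that $i_2\equiv i_1p^k\pmod\ell$ and $j_2\equiv j_1p^k\pmod\ell$.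
   Context: An integer $\ell$ is a primitive divisor of $p^d-1$ if $\ell\mid p^d-1$ but $\ell\nmid p^i-1$ for all $1\le i<d$. For a finite group $G=\langle b,w\rangle$, $\mathcal{D}(G,b,w)$ is the regular dessin with black vertices the right cosets of $\langle b\rangle$, white vertices the right cosets of $\langle w\rangle$, edges the elements of $G$, faces corresponding to right cosets of $\langle bw\rangle$; isomorphisms of dessins preserve colours, incidence and orientation. *)

theory Defs
  imports
    "HOL-Library.Cardinality"
    "HOL-Number_Theory.Cong"
    "HOL-Algebra.Generated_Groups"
begin

definition primitive_divisor :: "nat \<Rightarrow> nat \<Rightarrow> nat \<Rightarrow> bool" where
  "primitive_divisor l p d \<longleftrightarrow>
     l dvd p ^ d - 1 \<and> (\<forall>i. 1 \<le> i \<and> i < d \<longrightarrow> \<not> l dvd p ^ i - 1)"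

text \<open>
  The product of two affine maps is composition of functions, so maps act on the left.
  Inversion is an isomorphism onto the group with the opposite product, so the right-action
  convention only replaces each element by its inverse.
\<close>

definition AGL1 :: "('a::field \<Rightarrow> 'a) monoid" where
  "AGL1 = \<lparr>carrier = {f. \<exists>a c. a \<noteq> 0 \<and> f = (\<lambda>z. a * z + c)},
           monoid.mult = (\<circ>), one = id\<rparr>"

definition GL1 :: "('a::field \<Rightarrow> 'a) set" where
  "GL1 = {f. \<exists>a. a \<noteq> 0 \<and> f = (\<lambda>z. a * z)}"

definition translation_subgroup :: "('a::field \<Rightarrow> 'a) set" where
  "translation_subgroup = {f. \<exists>c. f = (\<lambda>z. z + c)}"

text \<open>
  The orientation of the surface is recorded by the two maps sending an edge to the next edge,
  in the positive sense, around its black and around its white vertex. A vertex is incident with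
  a face exactly when some edge is incident with both, so that incidence is not stored.
\<close>

record ('b, 'w, 'e, 'f) dessin =
  black_vertices :: "'b set"
  white_vertices :: "'w set"
  edges :: "'e set"
  faces :: "'f set"
  black_incident :: "'b \<Rightarrow> 'e \<Rightarrow> bool"
  white_incident :: "'w \<Rightarrow> 'e \<Rightarrow> bool"
  face_incident :: "'f \<Rightarrow> 'e \<Rightarrow> bool"
  black_rotation :: "'e \<Rightarrow> 'e"
  white_rotation :: "'e \<Rightarrow> 'e"

definition dessin_isomorphic ::
    "('b1, 'w1, 'e1, 'f1) dessin \<Rightarrow> ('b2, 'w2, 'e2, 'f2) dessin \<Rightarrow> bool" where
  "dessin_isomorphic D D' \<longleftrightarrow>
     (\<exists>\<beta> \<omega> \<epsilon> \<phi>.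
        bij_betw \<beta> (black_vertices D) (black_vertices D') \<and>
        bij_betw \<omega> (white_vertices D) (white_vertices D') \<and>
        bij_betw \<epsilon> (edges D) (edges D') \<and>
        bij_betw \<phi> (faces D) (faces D') \<and>
        (\<forall>v\<in>black_vertices D. \<forall>e\<in>edges D.
           black_incident D v e \<longleftrightarrow> black_incident D' (\<beta> v) (\<epsilon> e)) \<and>
        (\<forall>v\<in>white_vertices D. \<forall>e\<in>edges D.
           white_incident D v e \<longleftrightarrow> white_incident D' (\<omega> v) (\<epsilon> e)) \<and>
        (\<forall>f\<in>faces D. \<forall>e\<in>edges D.
           face_incident D f e \<longleftrightarrow> face_incident D' (\<phi> f) (\<epsilon> e)) \<and>
        (\<forall>e\<in>edges D. \<epsilon> (black_rotation D e) = black_rotation D' (\<epsilon> e)) \<and>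
        (\<forall>e\<in>edges D. \<epsilon> (white_rotation D e) = white_rotation D' (\<epsilon> e)))"

text \<open>
  Left multiplication by \<open>b\<close> and \<open>w\<close> rotates the edges around the black vertex \<open>\<langle>b\<rangle>g\<close> and the
  white vertex \<open>\<langle>w\<rangle>g\<close>; right multiplication by \<open>G\<close> gives automorphisms.
  The boundary of a face runs through the edges \<open>g\<close>, \<open>wg\<close>, \<open>bwg\<close>, \<open>wbwg\<close>, \<open>\<dots>\<close>; going from black
  to white along \<open>g\<close>, the coset \<open>\<langle>bw\<rangle>g\<close> labels the face on one side of the edge \<open>g\<close>, and
  \<open>\<langle>bw\<rangle>w\<^sup>-\<^sup>1g\<close> labels the face on the other side.
  The construction is meant for \<open>G\<close> finite and generated by \<open>b\<close> and \<open>w\<close>.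
\<close>

definition regular_dessin ::
    "('g, 'm) monoid_scheme \<Rightarrow> 'g \<Rightarrow> 'g \<Rightarrow> ('g set, 'g set, 'g, 'g set) dessin" where
  "regular_dessin G b w =
     \<lparr>black_vertices = rcosets\<^bsub>G\<^esub> (generate G {b}),
      white_vertices = rcosets\<^bsub>G\<^esub> (generate G {w}),
      edges = carrier G,
      faces = rcosets\<^bsub>G\<^esub> (generate G {b \<otimes>\<^bsub>G\<^esub> w}),
      black_incident = (\<lambda>v e. e \<in> v),
      white_incident = (\<lambda>v e. e \<in> v),
      face_incident = (\<lambda>f e. e \<in> f \<or> inv\<^bsub>G\<^esub> w \<otimes>\<^bsub>G\<^esub> e \<in> f),
      black_rotation = (\<lambda>e. b \<otimes>\<^bsub>G\<^esub> e),
      white_rotation = (\<lambda>e. w \<otimes>\<^bsub>G\<^esub> e)\<rparr>"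

end

theory Submission
  imports Defs "HOL-Number_Theory.Residues" "HOL-Algebra.Multiplicative_Group"
    "HOL-Computational_Algebra.Polynomial"
begin

text \<open>
  Isomorphisms of the two dessins are the automorphisms \<open>\<theta>\<close> of \<open>G\<close> with \<open>\<theta> b\<^sub>1 = b\<^sub>2\<close> and \<open>\<theta> w\<^sub>1 = w\<^sub>2\<close>,
  because \<open>b\<^sub>1\<close> and \<open>w\<^sub>1\<close> generate \<open>G\<close>. Let \<open>h\<close> be \<open>z \<mapsto> a z\<close>. Such a \<open>\<theta>\<close> preserves the translations,
  which are the elements of order \<open>1\<close> or \<open>p\<close>, so it induces an additive \<open>T\<close> on the field with
  \<open>T (a u) = s T u\<close>, where \<open>s\<close> is the linear part of \<open>\<theta> h\<close>. Hence \<open>s\<close> satisfies the equation of degree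
  \<open>d\<close> of \<open>a\<close> over the prime field, whose roots are the \<open>d\<close> distinct powers \<open>a\<^bsup>p^k\<^esup>\<close>. Comparing the
  linear parts of \<open>\<theta> b\<^sub>1 = b\<^sub>2\<close> and \<open>\<theta> (b\<^sub>1 w\<^sub>1) = b\<^sub>2 w\<^sub>2\<close> gives the congruences. Conversely, conjugation
  by a scalar multiple of \<open>z \<mapsto> z\<^bsup>p^k\<^esup>\<close> is such an automorphism.
\<close>

section \<open>Finite fields\<close>

text \<open>Here \<open>a\<close> stands for the scalar by which \<open>h\<close> multiplies; the
  last assumption says that its multiplicative order is exactly \<open>l\<close>.\<close>

locale primitive_field_element =
  fixes p d l :: nat and a :: "'a::{finite,field}"
  assumes prime_p: "prime p" and d_ge_1: "d \<ge> 1"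
    and primitive: "primitive_divisor l p d"
    and card_field: "CARD('a) = p ^ d"
    and power_eq_1_iff: "a ^ n = 1 \<longleftrightarrow> l dvd n"
begin

lemma l_pos: "l > 0"
proof -
  have "p ^ d > 1"
    using prime_gt_1_nat[OF prime_p] d_ge_1 by (intro one_less_power) auto
  then show ?thesis
    using primitive unfolding primitive_divisor_def by (auto intro!: Nat.gr0I)
qed

lemma power_l: "a ^ l = 1"
  by (simp add: power_eq_1_iff)

lemma a_nonzero: "a \<noteq> 0"
  using power_l l_pos by (auto simp: power_0_left)

text \<open>Turns equalities between linear parts into the congruences of condition (ii).\<close>

lemma power_eq_iff: "a ^ m = a ^ n \<longleftrightarrow> [m = n] (mod l)"
proof -
  have *: "a ^ m = a ^ n \<longleftrightarrow> [m = n] (mod l)" if "m \<le> n" for m n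
  proof -
    have "a ^ n = a ^ m * a ^ (n - m)"
      using that by (simp flip: power_add)
    then have "a ^ m = a ^ n \<longleftrightarrow> a ^ (n - m) = 1"
      using a_nonzero by auto
    also have "\<dots> \<longleftrightarrow> [m = n] (mod l)"
      using that cong_altdef_nat[of m n l] by (simp add: power_eq_1_iff cong_sym_eq[of m n])
    finally show ?thesis .
  qed
  show ?thesis
    using *[of m n] *[of n m] by (metis cong_sym_eq linear)
qed

lemma char_eq: "CHAR('a) = p"
proof -
  have "prime CHAR('a)"
    by (simp add: finite_imp_CHAR_pos prime_CHAR_semidom)
  moreover have "CHAR('a) dvd p ^ d"
    using CHAR_dvd_CARD[where ?'a = 'a] card_field by simp
  ultimately show ?thesis
    using prime_p prime_dvd_power primes_dvd_imp_eq by blast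
qed

lemma prime_char: "prime CHAR('a)"
  by (simp add: char_eq prime_p)

lemma frobenius_add: "(x + y) ^ p ^ k = x ^ p ^ k + y ^ p ^ k" for x y :: 'a
  by (rule freshmans_dream'[OF prime_char]) (simp add: char_eq)

text \<open>Additivity for \<open>x = (x - y) + y\<close> gives \<open>(x - y) ^ p ^ k = 0\<close>,
  and a field has no nonzero nilpotents.\<close>

lemma frobenius_inj: "x ^ p ^ k = y ^ p ^ k \<Longrightarrow> x = y" for x y :: 'a
proof -
  assume "x ^ p ^ k = y ^ p ^ k"
  then have "(x - y) ^ p ^ k = 0"
    using frobenius_add[of "x - y" y k] by simp
  then show "x = y"
    by simp
qed

lemma frobenius_of_nat: "(of_nat n :: 'a) ^ p ^ k = of_nat n"
  using prime_gt_0_nat[OF prime_p]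
  by (induction n) (auto simp: frobenius_add power_0_left)

text \<open>The \<open>p ^ k\<close>-th power map is additive and multiplicative and fixes the
  coefficients, so it commutes with evaluation.\<close>

lemma poly_frobenius:
  fixes Q :: "'a poly"
  assumes "\<And>i. coeff Q i ^ p ^ k = coeff Q i"
  shows "poly Q (x ^ p ^ k) = poly Q x ^ p ^ k"
proof -
  have "poly Q x ^ p ^ k = (\<Sum>i\<le>degree Q. (coeff Q i * x ^ i) ^ p ^ k)"
    unfolding poly_altdef
    by (rule freshmans_dream_sum'[OF prime_char]) (simp add: char_eq)
  also have "\<dots> = (\<Sum>i\<le>degree Q. coeff Q i * (x ^ p ^ k) ^ i)"
    by (simp add: assms power_mult_distrib mult.commute flip: power_mult)
  finally show ?thesis
    by (simp add: poly_altdef)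
qed

text \<open>If \<open>a ^ p ^ m = a ^ p ^ n\<close> with \<open>m < n < d\<close>, then
  \<open>l\<close> divides \<open>p ^ m * (p ^ (n - m) - 1)\<close>. As a divisor of
  \<open>p ^ d - 1\<close>, \<open>l\<close> is coprime to \<open>p\<close>, so it divides
  \<open>p ^ (n - m) - 1\<close>, against primitivity.\<close>

lemma conjugates_inj: "inj_on (\<lambda>k. a ^ p ^ k) {..<d}"
proof -
  have False if "m < n" "n < d" "a ^ p ^ m = a ^ p ^ n" for m n
  proof -
    have "p ^ n - p ^ m = p ^ m * (p ^ (n - m) - 1)"
      using that by (simp add: diff_mult_distrib2 flip: power_add)
    moreover have "l dvd p ^ n - p ^ m"
      using that prime_gt_0_nat[OF prime_p] cong_altdef_nat[of "p ^ m" "p ^ n" l]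
      by (simp add: power_eq_iff cong_sym_eq[of "p ^ m"] power_increasing)
    ultimately have "l dvd p ^ m * (p ^ (n - m) - 1)"
      by simp
    moreover have "coprime l (p ^ m)"
    proof -
      have "\<not> p dvd l"
      proof
        assume "p dvd l"
        then have "p dvd p ^ d - 1"
          using primitive unfolding primitive_divisor_def by (meson dvd_trans)
        moreover have "p dvd p ^ d"
          using d_ge_1 by (simp add: dvd_power)
        moreover have "p ^ d \<ge> 1"
          using prime_gt_0_nat[OF prime_p] by simp
        ultimately have "p dvd 1"
          by (metis dvd_diffD1)
        then show False
          using prime_p by auto
      qed
      then show ?thesis
        using prime_imp_coprime[OF prime_p] by (simp add: coprime_commute[of l])
    qed
    ultimately have "l dvd p ^ (n - m) - 1"
      by (simp add: coprime_dvd_mult_right_iff)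
    moreover have "1 \<le> n - m" "n - m < d"
      using that by auto
    ultimately show False
      using primitive unfolding primitive_divisor_def by blast
  qed
  then show ?thesis
    by (intro inj_onI) (metis lessThan_iff linorder_neqE_nat)
qed

lemma poly_conjugate_root:
  fixes Q :: "'a poly"
  assumes "\<And>i k. coeff Q i ^ p ^ k = coeff Q i" and "poly Q a = 0"
  shows "poly Q (a ^ p ^ k) = 0"
  using poly_frobenius[of Q k a] assms prime_gt_0_nat[OF prime_p] by simp

text \<open>Along with \<open>a\<close>, its \<open>d\<close> distinct conjugates are roots of
  \<open>Q\<close>, too many for a nonzero polynomial of smaller degree.\<close>

lemma degree_ge_if_root:
  fixes Q :: "'a poly"
  assumes "\<And>i k. coeff Q i ^ p ^ k = coeff Q i" and "poly Q a = 0" and "Q \<noteq> 0"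
  shows "degree Q \<ge> d"
proof -
  have "d = card ((\<lambda>k. a ^ p ^ k) ` {..<d})"
    by (simp add: card_image conjugates_inj)
  also have "\<dots> \<le> card {x. poly Q x = 0}"
    using poly_conjugate_root[OF assms(1,2)] by (intro card_mono) auto
  also have "\<dots> \<le> degree Q"
    by (rule card_poly_roots_bound[OF assms(3)])
  finally show ?thesis .
qed

text \<open>The \<open>d\<close> conjugates of \<open>a\<close> already exhaust the roots allowed by
  the degree, so a further root \<open>s\<close> would be one too many.\<close>

lemma root_is_conjugate:
  fixes Q :: "'a poly"
  assumes "\<And>i k. coeff Q i ^ p ^ k = coeff Q i" and "poly Q a = 0"
    and "degree Q = d" and "poly Q s = 0"
  shows "\<exists>k<d. s = a ^ p ^ k"
proof (rule ccontr)
  assume "\<not> ?thesis"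
  then have s: "s \<notin> (\<lambda>k. a ^ p ^ k) ` {..<d}"
    by auto
  have "Q \<noteq> 0"
    using assms(3) d_ge_1 by auto
  have "Suc d = card (insert s ((\<lambda>k. a ^ p ^ k) ` {..<d}))"
    using s by (simp add: card_image conjugates_inj)
  also have "\<dots> \<le> card {x. poly Q x = 0}"
    using poly_conjugate_root[OF assms(1,2)] assms(4) by (intro card_mono) auto
  also have "\<dots> \<le> degree Q"
    by (rule card_poly_roots_bound[OF \<open>Q \<noteq> 0\<close>])
  finally show False
    using assms(3) by simp
qed

text \<open>A relation of degree below \<open>d\<close> over the prime field would have the \<open>d\<close> distinct roots
  \<open>a\<^bsup>p^k\<^esup>\<close>, so the powers \<open>1, a, \<dots>, a\<^bsup>d-1\<^esup>\<close> have \<open>p\<^sup>d = CARD('a)\<close> distinct combinations.\<close>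

lemma powers_span: "\<exists>f. v = (\<Sum>i<d. of_nat (f i) * a ^ i)"
proof -
  \<comment> \<open>With extensional functions a coefficient tuple is determined by its entries at
    indices below \<open>d\<close>, and there are exactly \<open>p ^ d\<close> tuples.\<close>
  define F :: "(nat \<Rightarrow> nat) set" where "F = {..<d} \<rightarrow>\<^sub>E {..<p}"
  define ev where "ev f = (\<Sum>i<d. of_nat (f i) * a ^ i)" for f
  have "inj_on ev F"
  proof (rule inj_onI)
    fix f g assume fg: "f \<in> F" "g \<in> F" and eq: "ev f = ev g"
    define Q :: "'a poly" where "Q = (\<Sum>i<d. monom (of_nat (f i) - of_nat (g i)) i)"
    have coeff_Q: "coeff Q i = (if i < d then of_nat (f i) - of_nat (g i) else 0)" for i
      by (simp add: Q_def coeff_sum)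
    \<comment> \<open>Additivity is applied to \<open>f i = (f i - g i) + g i\<close>: the power map
      fixes both naturals, hence their difference.\<close>
    have fixed: "coeff Q i ^ p ^ k = coeff Q i" for i k
      using frobenius_add[of "of_nat (f i) - of_nat (g i)" "of_nat (g i)" k]
        prime_gt_0_nat[OF prime_p]
      by (simp add: coeff_Q frobenius_of_nat eq_diff_eq)
    have root: "poly Q a = 0"
      using eq by (simp add: Q_def ev_def poly_sum poly_monom sum_subtractf left_diff_distrib)
    have "degree Q < d"
      using d_ge_1 by (intro degree_lessI) (auto simp: coeff_Q)
    then have "Q = 0"
      using degree_ge_if_root[OF fixed root] by fastforce
    have "f i = g i" if "i < d" for i
    proof -
      have "of_nat (f i) = (of_nat (g i) :: 'a)"
        using coeff_Q[of i] \<open>Q = 0\<close> that by simp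
      then have "[f i = g i] (mod p)"
        by (simp add: of_nat_eq_iff_cong_CHAR char_eq)
      moreover have "f i < p" "g i < p"
        using fg that by (auto simp: F_def)
      ultimately show ?thesis
        by (simp add: cong_less_modulus_unique_nat)
    qed
    then show "f = g"
      using fg unfolding F_def by (intro PiE_ext) auto
  qed
  moreover have "card F = CARD('a)"
    by (simp add: F_def card_PiE card_field)
  ultimately have "card (ev ` F) = CARD('a)"
    by (simp add: card_image)
  then have "ev ` F = UNIV"
    by (intro card_subset_eq) auto
  then show ?thesis
    unfolding ev_def by (metis (no_types, lifting) UNIV_I imageE)
qed

text \<open>By \<open>powers_span\<close> every field element arises from \<open>0\<close> and
  \<open>1\<close> by addition and multiplication by \<open>a\<close>. This later produces all
  translations from a single one.\<close>

lemma powers_induct: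
  assumes "P 0" and "P 1" and add: "\<And>u v. P u \<Longrightarrow> P v \<Longrightarrow> P (u + v)"
    and mult: "\<And>v. P v \<Longrightarrow> P (a * v)"
  shows "P v"
proof -
  have "P (a ^ i)" for i
    by (induction i) (auto simp: assms)
  then have P_term: "P (of_nat n * a ^ i)" for n i
    by (induction n) (auto simp: assms distrib_right)
  obtain f where "v = (\<Sum>i<d. of_nat (f i) * a ^ i)"
    using powers_span by blast
  moreover have "P (\<Sum>i<m. of_nat (f i) * a ^ i)" for m
    by (induction m) (auto simp: assms P_term)
  ultimately show ?thesis
    by simp
qed

text \<open>Additivity lets \<open>S\<close> pass through natural multiples, so applying
  \<open>S\<close> to the expansion of \<open>a ^ d\<close> in lower powers and cancelling
  \<open>S 1\<close> gives the same monic equation for \<open>s\<close>. Its roots are the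
  conjugates of \<open>a\<close>.\<close>

lemma semilinear_eigenvalue:
  assumes S_add: "\<And>u v. S (u + v) = S u + S v" and S_1: "S 1 \<noteq> (0 :: 'a)"
    and S_mult: "\<And>u. S (a * u) = s * S u"
  shows "\<exists>k<d. s = a ^ p ^ k"
proof -
  have S_0: "S 0 = 0"
    using S_add[of 0 0] by (metis add.right_neutral add_left_cancel)
  have S_power: "S (a ^ i) = s ^ i * S 1" for i
    by (induction i) (auto simp: S_mult)
  have S_term: "S (of_nat n * a ^ i) = of_nat n * s ^ i * S 1" for n i
    by (induction n) (auto simp: S_0 S_add S_power algebra_simps)
  have S_sum: "S (\<Sum>i<m. of_nat (f i) * a ^ i) = (\<Sum>i<m. of_nat (f i) * s ^ i) * S 1" for f m
    by (induction m) (auto simp: S_0 S_add S_term algebra_simps)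
  obtain f where f: "a ^ d = (\<Sum>i<d. of_nat (f i) * a ^ i)"
    using powers_span by blast
  then have s: "s ^ d = (\<Sum>i<d. of_nat (f i) * s ^ i)"
    using S_sum[of f d] S_power[of d] S_1 by simp
  \<comment> \<open>\<open>Q\<close> is \<open>X ^ d\<close> minus the expansion of
    \<open>a ^ d\<close>; with the lower terms split off as \<open>R\<close>, its degree is
    evident.\<close>
  define R :: "'a poly" where "R = (\<Sum>i<d. monom (- of_nat (f i)) i)"
  define Q where "Q = monom 1 d + R"
  have coeff_R: "coeff R i = (if i < d then - of_nat (f i) else 0)" for i
    by (simp add: R_def coeff_sum)
  \<comment> \<open>Additivity for \<open>of_nat n + (- of_nat n) = 0\<close> spares a case
    distinction on the sign of \<open>(-1) ^ p ^ k\<close>.\<close>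
  have minus_fixed: "(- of_nat n) ^ p ^ k = (- of_nat n :: 'a)" for n k
    using frobenius_add[of "of_nat n" "- of_nat n" k] prime_gt_0_nat[OF prime_p]
    by (simp add: frobenius_of_nat eq_neg_iff_add_eq_0 add.commute power_0_left)
  have fixed: "coeff Q i ^ p ^ k = coeff Q i" for i k
    using prime_gt_0_nat[OF prime_p] by (auto simp: Q_def coeff_R minus_fixed)
  have "degree R < d"
    using d_ge_1 by (intro degree_lessI) (auto simp: coeff_R)
  then have deg: "degree Q = d"
    by (simp add: Q_def degree_add_eq_left degree_monom_eq)
  have "poly Q x = x ^ d - (\<Sum>i<d. of_nat (f i) * x ^ i)" for x
    by (simp add: Q_def R_def poly_sum poly_monom sum_negf)
  then show ?thesis
    using root_is_conjugate[OF fixed _ deg] f s by simp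
qed

end

section \<open>Isomorphisms of regular dessins\<close>

text \<open>The edge map intertwines left multiplication by \<open>b\<close> and \<open>w\<close>
  with that by \<open>b'\<close> and \<open>w'\<close>. Since \<open>b\<close> and \<open>w\<close>
  generate \<open>G\<close>, it is a homomorphism followed by a right multiplication.\<close>

lemma dessin_isomorphic_imp_iso:
  fixes G :: "('g, 'm) monoid_scheme" and K :: "('k, 'n) monoid_scheme"
  assumes "group G" and "group K"
    and b: "b \<in> carrier G" "b' \<in> carrier K" and w: "w \<in> carrier G" "w' \<in> carrier K"
    and gen: "generate G {b, w} = carrier G"
    and iso: "dessin_isomorphic (regular_dessin G b w) (regular_dessin K b' w')"
  shows "\<exists>\<theta>\<in>iso G K. \<theta> b = b' \<and> \<theta> w = w'"
proof -
  interpret G: group G by fact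
  interpret K: group K by fact
  obtain \<epsilon> where bij: "bij_betw \<epsilon> (carrier G) (carrier K)"
    and \<epsilon>_b: "\<And>e. e \<in> carrier G \<Longrightarrow> \<epsilon> (b \<otimes>\<^bsub>G\<^esub> e) = b' \<otimes>\<^bsub>K\<^esub> \<epsilon> e"
    and \<epsilon>_w: "\<And>e. e \<in> carrier G \<Longrightarrow> \<epsilon> (w \<otimes>\<^bsub>G\<^esub> e) = w' \<otimes>\<^bsub>K\<^esub> \<epsilon> e"
    using iso unfolding dessin_isomorphic_def regular_dessin_def by auto
  have \<epsilon>_closed: "\<epsilon> e \<in> carrier K" if "e \<in> carrier G" for e
    using bij that by (auto simp: bij_betw_def)
  \<comment> \<open>Right multiplication in \<open>K\<close> commutes with the rotations, so the
    edge map may be normalised to send the identity to the identity.\<close>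
  define \<theta> where "\<theta> g = \<epsilon> g \<otimes>\<^bsub>K\<^esub> inv\<^bsub>K\<^esub> \<epsilon> \<one>\<^bsub>G\<^esub>" for g
  have \<theta>_closed: "\<theta> g \<in> carrier K" if "g \<in> carrier G" for g
    using that by (simp add: \<theta>_def \<epsilon>_closed)
  have \<epsilon>_eq: "\<epsilon> g = \<theta> g \<otimes>\<^bsub>K\<^esub> \<epsilon> \<one>\<^bsub>G\<^esub>" if "g \<in> carrier G" for g
    using that by (simp add: \<theta>_def \<epsilon>_closed K.m_assoc)
  \<comment> \<open>Evaluating at \<open>e = \<one>\<close> shows that the multiplier
    \<open>g'\<close> belonging to \<open>g\<close> can only be \<open>\<theta> g\<close>.\<close>
  have translation: "\<theta> g = g'"
    if "g \<in> carrier G" "g' \<in> carrier K"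
      "\<And>e. e \<in> carrier G \<Longrightarrow> \<epsilon> (g \<otimes>\<^bsub>G\<^esub> e) = g' \<otimes>\<^bsub>K\<^esub> \<epsilon> e" for g g'
    using that(3)[of "\<one>\<^bsub>G\<^esub>"] that(1,2) by (simp add: \<theta>_def \<epsilon>_closed K.m_assoc)
  \<comment> \<open>The elements \<open>g\<close> for which such a multiplier exists contain
    \<open>b\<close> and \<open>w\<close> and are closed under the group operations.\<close>
  have "\<exists>g'\<in>carrier K. \<forall>e\<in>carrier G. \<epsilon> (g \<otimes>\<^bsub>G\<^esub> e) = g' \<otimes>\<^bsub>K\<^esub> \<epsilon> e"
    if "g \<in> generate G {b, w}" for g
    using that
  proof induction
    case one
    then show ?case
      by (intro bexI[of _ "\<one>\<^bsub>K\<^esub>"]) (auto simp: \<epsilon>_closed)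
  next
    case (incl h)
    then show ?case
      using b w \<epsilon>_b \<epsilon>_w by blast
  next
    case (inv h)
    then obtain h' where h: "h \<in> carrier G" "h' \<in> carrier K"
      "\<And>e. e \<in> carrier G \<Longrightarrow> \<epsilon> (h \<otimes>\<^bsub>G\<^esub> e) = h' \<otimes>\<^bsub>K\<^esub> \<epsilon> e"
      using b w \<epsilon>_b \<epsilon>_w by blast
    show ?case
    proof (intro bexI[of _ "inv\<^bsub>K\<^esub> h'"] ballI)
      fix e assume e: "e \<in> carrier G"
      have "\<epsilon> e = h' \<otimes>\<^bsub>K\<^esub> \<epsilon> (inv\<^bsub>G\<^esub> h \<otimes>\<^bsub>G\<^esub> e)"
        using h(1) e h(3)[of "inv\<^bsub>G\<^esub> h \<otimes>\<^bsub>G\<^esub> e"] by (simp flip: G.m_assoc)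
      then show "\<epsilon> (inv\<^bsub>G\<^esub> h \<otimes>\<^bsub>G\<^esub> e) = inv\<^bsub>K\<^esub> h' \<otimes>\<^bsub>K\<^esub> \<epsilon> e"
        using h e \<epsilon>_closed by (metis G.inv_closed G.m_closed K.inv_solve_left)
    qed (use h in simp)
  next
    case (eng h1 h2)
    then obtain h1' h2' where h': "h1' \<in> carrier K" "h2' \<in> carrier K"
      "\<And>e. e \<in> carrier G \<Longrightarrow> \<epsilon> (h1 \<otimes>\<^bsub>G\<^esub> e) = h1' \<otimes>\<^bsub>K\<^esub> \<epsilon> e"
      "\<And>e. e \<in> carrier G \<Longrightarrow> \<epsilon> (h2 \<otimes>\<^bsub>G\<^esub> e) = h2' \<otimes>\<^bsub>K\<^esub> \<epsilon> e"
      by blast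
    have "h1 \<in> carrier G" "h2 \<in> carrier G"
      using eng gen by auto
    then show ?case
      using h' by (intro bexI[of _ "h1' \<otimes>\<^bsub>K\<^esub> h2'"]) (auto simp: G.m_assoc K.m_assoc \<epsilon>_closed)
  qed
  then have \<epsilon>_mult: "\<epsilon> (g \<otimes>\<^bsub>G\<^esub> e) = \<theta> g \<otimes>\<^bsub>K\<^esub> \<epsilon> e"
    if "g \<in> carrier G" "e \<in> carrier G" for g e
    using translation that gen by metis
  have "\<theta> \<in> hom G K"
  proof (rule homI)
    fix g e assume "g \<in> carrier G" "e \<in> carrier G"
    then show "\<theta> (g \<otimes>\<^bsub>G\<^esub> e) = \<theta> g \<otimes>\<^bsub>K\<^esub> \<theta> e"
      unfolding \<theta>_def[of "g \<otimes>\<^bsub>G\<^esub> e"] \<theta>_def[of e]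
      by (simp add: \<epsilon>_mult \<epsilon>_closed \<theta>_closed K.m_assoc)
  qed (rule \<theta>_closed)
  moreover have "bij_betw \<theta> (carrier G) (carrier K)"
  proof (rule bij_betw_imageI)
    show "inj_on \<theta> (carrier G)"
      using bij by (intro inj_onI) (metis \<epsilon>_eq bij_betw_imp_inj_on inj_onD)
    show "\<theta> ` carrier G = carrier K"
    proof (intro equalityI subsetI)
      fix y assume y: "y \<in> carrier K"
      then have "y \<otimes>\<^bsub>K\<^esub> \<epsilon> \<one>\<^bsub>G\<^esub> \<in> \<epsilon> ` carrier G"
        using bij by (simp add: bij_betw_def \<epsilon>_closed)
      then obtain g where g: "g \<in> carrier G" "\<epsilon> g = y \<otimes>\<^bsub>K\<^esub> \<epsilon> \<one>\<^bsub>G\<^esub>"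
        by auto
      then have "\<theta> g = y"
        using y by (simp add: \<theta>_def \<epsilon>_closed K.m_assoc)
      then show "y \<in> \<theta> ` carrier G"
        using g by blast
    qed (auto simp: \<theta>_closed)
  qed
  ultimately have "\<theta> \<in> iso G K"
    by (simp add: iso_def)
  then show ?thesis
    using translation b w \<epsilon>_b \<epsilon>_w by blast
qed

text \<open>Provides the bijections on vertices and faces, with \<open>S\<close> equal to
  \<open>{b}\<close>, \<open>{w}\<close> and \<open>{b \<otimes> w}\<close>. It holds because
  isomorphisms respect generated subgroups and products.\<close>

lemma iso_bij_betw_rcosets:
  fixes G :: "('g, 'm) monoid_scheme" and K :: "('k, 'n) monoid_scheme"
  assumes "group G" and "group K" and \<theta>: "\<theta> \<in> iso G K" and S: "S \<subseteq> carrier G"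
  shows "bij_betw ((`) \<theta>) (rcosets\<^bsub>G\<^esub> (generate G S)) (rcosets\<^bsub>K\<^esub> (generate K (\<theta> ` S)))"
proof -
  interpret group_hom G K \<theta>
    using assms by (auto simp: group_hom_def group_hom_axioms_def iso_def)
  have bij: "bij_betw \<theta> (carrier G) (carrier K)"
    using \<theta> by (simp add: iso_def)
  have gen: "generate K (\<theta> ` S) = \<theta> ` generate G S"
    by (rule generate_img[OF S])
  have sub: "generate G S \<subseteq> carrier G"
    using S by (rule G.generate_incl)
  have coset: "\<theta> ` (generate G S #>\<^bsub>G\<^esub> g) = \<theta> ` generate G S #>\<^bsub>K\<^esub> \<theta> g" if "g \<in> carrier G" for g
  proof -
    have "\<theta> (s \<otimes>\<^bsub>G\<^esub> g) = \<theta> s \<otimes>\<^bsub>K\<^esub> \<theta> g" if "s \<in> generate G S" for s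
      using that sub \<open>g \<in> carrier G\<close> by auto
    then show ?thesis
      unfolding r_coset_def by (force simp: image_iff)
  qed
  show ?thesis
  proof (rule bij_betw_imageI)
    have "rcosets\<^bsub>G\<^esub> (generate G S) \<subseteq> Pow (carrier G)"
      using G.rcosets_subset_PowG G.generate_is_subgroup[OF S] by blast
    then show "inj_on ((`) \<theta>) (rcosets\<^bsub>G\<^esub> (generate G S))"
      using bij by (meson bij_betw_def inj_on_image_Pow inj_on_subset)
    show "(`) \<theta> ` (rcosets\<^bsub>G\<^esub> (generate G S)) = rcosets\<^bsub>K\<^esub> (generate K (\<theta> ` S))"
    proof -
      have "rcosets\<^bsub>K\<^esub> (generate K (\<theta> ` S)) = (\<lambda>g. generate K (\<theta> ` S) #>\<^bsub>K\<^esub> g) ` \<theta> ` carrier G"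
        using bij by (auto simp: RCOSETS_def bij_betw_def)
      also have "\<dots> = (`) \<theta> ` (rcosets\<^bsub>G\<^esub> (generate G S))"
        by (auto simp: RCOSETS_def gen coset image_iff)
      finally show ?thesis ..
    qed
  qed
qed

text \<open>Edges are mapped by \<open>\<theta>\<close>, vertices and faces, being cosets, by taking
  images under \<open>\<theta>\<close>. Injectivity on the carrier preserves incidence in both
  directions.\<close>

lemma iso_imp_dessin_isomorphic:
  fixes G :: "('g, 'm) monoid_scheme" and K :: "('k, 'n) monoid_scheme"
  assumes G: "group G" and K: "group K" and \<theta>: "\<theta> \<in> iso G K"
    and b: "b \<in> carrier G" and w: "w \<in> carrier G"
  shows "dessin_isomorphic (regular_dessin G b w) (regular_dessin K (\<theta> b) (\<theta> w))"
proof -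
  interpret group_hom G K \<theta>
    using assms by (auto simp: group_hom_def group_hom_axioms_def iso_def)
  have bij: "bij_betw \<theta> (carrier G) (carrier K)"
    using \<theta> by (simp add: iso_def)
  have mem: "\<theta> e \<in> \<theta> ` v \<longleftrightarrow> e \<in> v"
    if "v \<in> rcosets\<^bsub>G\<^esub> (generate G {g})" "g \<in> carrier G" "e \<in> carrier G" for v g e
  proof -
    have "v \<subseteq> carrier G"
      using that G.rcosets_subset_PowG[OF G.generate_is_subgroup, of "{g}"] by blast
    then show ?thesis
      using bij that unfolding bij_betw_def by (intro inj_on_image_mem_iff[of \<theta> "carrier G"]) auto
  qed
  have bij_cosets: "bij_betw ((`) \<theta>) (rcosets\<^bsub>G\<^esub> (generate G {g})) (rcosets\<^bsub>K\<^esub> (generate K {\<theta> g}))"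
    if "g \<in> carrier G" for g
    using iso_bij_betw_rcosets[OF G K \<theta>, of "{g}"] that by simp
  \<comment> \<open>Face incidence also tests the edge \<open>inv w \<otimes> e\<close>; writing its
    counterpart as a value of \<open>\<theta>\<close> makes \<open>mem\<close> applicable.\<close>
  have face: "inv\<^bsub>K\<^esub> \<theta> w \<otimes>\<^bsub>K\<^esub> \<theta> e = \<theta> (inv\<^bsub>G\<^esub> w \<otimes>\<^bsub>G\<^esub> e)" if "e \<in> carrier G" for e
    using that w by simp
  show ?thesis
    unfolding dessin_isomorphic_def regular_dessin_def
  proof (intro exI[of _ "(`) \<theta>"] exI[of _ \<theta>] conjI ballI; simp only: dessin.simps)
    show "bij_betw ((`) \<theta>) (rcosets\<^bsub>G\<^esub> generate G {b \<otimes>\<^bsub>G\<^esub> w})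
      (rcosets\<^bsub>K\<^esub> generate K {\<theta> b \<otimes>\<^bsub>K\<^esub> \<theta> w})"
      using bij_cosets[of "b \<otimes>\<^bsub>G\<^esub> w"] b w by simp
    fix f e assume f: "f \<in> rcosets\<^bsub>G\<^esub> generate G {b \<otimes>\<^bsub>G\<^esub> w}" and e: "e \<in> carrier G"
    have "\<theta> e \<in> \<theta> ` f \<longleftrightarrow> e \<in> f"
      and "\<theta> (inv\<^bsub>G\<^esub> w \<otimes>\<^bsub>G\<^esub> e) \<in> \<theta> ` f \<longleftrightarrow> inv\<^bsub>G\<^esub> w \<otimes>\<^bsub>G\<^esub> e \<in> f"
      by (rule mem[OF f]; use b w e in simp)+
    then show "(e \<in> f \<or> inv\<^bsub>G\<^esub> w \<otimes>\<^bsub>G\<^esub> e \<in> f) =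
      (\<theta> e \<in> \<theta> ` f \<or> inv\<^bsub>K\<^esub> \<theta> w \<otimes>\<^bsub>K\<^esub> \<theta> e \<in> \<theta> ` f)"
      by (simp only: face[OF e])
  qed (use b w bij bij_cosets mem in auto)
qed

section \<open>Affine groups\<close>

definition affine_map :: "'a::field \<Rightarrow> 'a \<Rightarrow> 'a \<Rightarrow> 'a" where
  "affine_map u c = (\<lambda>z. u * z + c)"

lemma affine_map_comp: "affine_map u c \<circ> affine_map v e = affine_map (u * v) (u * e + c)"
  by (auto simp: affine_map_def algebra_simps)

lemma affine_map_eq_iff: "affine_map u c = affine_map v e \<longleftrightarrow> u = v \<and> c = e"
proof
  assume eq: "affine_map u c = affine_map v e"
  show "u = v \<and> c = e"
    using fun_cong[OF eq, of 0] fun_cong[OF eq, of 1] by (simp add: affine_map_def)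
qed simp

lemma affine_map_id: "affine_map 1 0 = id"
  by (auto simp: affine_map_def)

lemma mult_AGL1 [simp]: "f \<otimes>\<^bsub>AGL1\<^esub> g = f \<circ> g"
  and one_AGL1 [simp]: "\<one>\<^bsub>AGL1\<^esub> = id"
  by (simp_all add: AGL1_def)

lemma carrier_AGL1: "carrier AGL1 = {affine_map u c | u c. u \<noteq> 0}"
  by (auto simp: AGL1_def affine_map_def)

lemma group_AGL1: "group (AGL1 :: ('a::field \<Rightarrow> 'a) monoid)"
proof (rule groupI)
  fix f :: "'a \<Rightarrow> 'a" assume "f \<in> carrier AGL1"
  then obtain u c where f: "f = affine_map u c" "u \<noteq> 0"
    by (auto simp: carrier_AGL1)
  then have "affine_map (inverse u) (- inverse u * c) \<circ> f = id"
    by (simp add: affine_map_comp flip: affine_map_id)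
  moreover have "affine_map (inverse u) (- inverse u * c) \<in> carrier AGL1"
    using f by (auto simp: carrier_AGL1)
  ultimately show "\<exists>g\<in>carrier AGL1. g \<otimes>\<^bsub>AGL1\<^esub> f = \<one>\<^bsub>AGL1\<^esub>"
    by auto
next
  show "\<one>\<^bsub>AGL1\<^esub> \<in> carrier (AGL1 :: ('a \<Rightarrow> 'a) monoid)"
    by (auto simp: carrier_AGL1 simp flip: affine_map_id)
next
  fix f g :: "'a \<Rightarrow> 'a" assume "f \<in> carrier AGL1" "g \<in> carrier AGL1"
  then obtain u c v e where "f = affine_map u c" "u \<noteq> 0" "g = affine_map v e" "v \<noteq> 0"
    by (auto simp: carrier_AGL1)
  then show "f \<otimes>\<^bsub>AGL1\<^esub> g \<in> carrier AGL1"
    by (auto simp: carrier_AGL1 affine_map_comp)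
qed (auto simp: comp_assoc)

lemma pow_AGL1_restrict:
  "affine_map u 0 [^]\<^bsub>AGL1\<lparr>carrier := S\<rparr>\<^esub> (n :: nat) = affine_map (u ^ n) 0"
  by (induction n) (auto simp: affine_map_id affine_map_comp mult.commute)

lemma pow_AGL1: "affine_map u 0 [^]\<^bsub>AGL1\<^esub> (n :: nat) = affine_map (u ^ n) 0"
  by (induction n) (auto simp: affine_map_id affine_map_comp mult.commute)

text \<open>In a finite group natural powers exhaust a cyclic subgroup, and its cardinality is the
  order of the generator. The second claim turns \<open>card H = l\<close> into the order of
  \<open>a\<close>.\<close>

lemma generate_AGL1_homothety:
  fixes u :: "'a::{finite,field}"
  assumes "u \<noteq> 0"
  shows "generate AGL1 {affine_map u 0} = range (\<lambda>n. affine_map (u ^ n) 0)"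
    and "u ^ n = 1 \<longleftrightarrow> card (generate AGL1 {affine_map u 0}) dvd n"
proof -
  interpret group "AGL1 :: ('a \<Rightarrow> 'a) monoid"
    by (rule group_AGL1)
  have u: "affine_map u 0 \<in> carrier AGL1"
    using assms by (auto simp: carrier_AGL1)
  show "generate AGL1 {affine_map u 0} = range (\<lambda>n. affine_map (u ^ n) 0)"
    using generate_pow_on_finite_carrier[OF _ u] by (auto simp: pow_AGL1)
  show "u ^ n = 1 \<longleftrightarrow> card (generate AGL1 {affine_map u 0}) dvd n"
    using pow_eq_id[OF u, of n]
    by (simp add: generate_pow_card[OF u] pow_AGL1 affine_map_eq_iff flip: affine_map_id)
qed

section \<open>The semidirect product of translations and powers of \<open>h\<close>, its generators
  and automorphisms\<close>

context primitive_field_element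
begin

text \<open>This is \<open>N <#> H\<close> in coordinates. Natural exponents suffice because
  \<open>a\<close> has finite order.\<close>

definition affine_group :: "('a \<Rightarrow> 'a) monoid" where
  "affine_group = AGL1\<lparr>carrier := {affine_map (a ^ n) c | n c. True}\<rparr>"

lemma carrier_affine_group: "carrier affine_group = {affine_map (a ^ n) c | n c. True}"
  by (simp add: affine_group_def)

lemma mult_affine_group [simp]: "f \<otimes>\<^bsub>affine_group\<^esub> g = f \<circ> g"
  and one_affine_group [simp]: "\<one>\<^bsub>affine_group\<^esub> = id"
  by (simp_all add: affine_group_def)

lemma affine_map_in_affine_group [simp]: "affine_map (a ^ n) c \<in> carrier affine_group"
  by (auto simp: carrier_affine_group)

lemma translation_in_affine_group [simp]: "affine_map 1 c \<in> carrier affine_group"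
  using affine_map_in_affine_group[of 0] by simp

lemma pow_affine_group:
  "affine_map u 0 [^]\<^bsub>affine_group\<^esub> (n :: nat) = affine_map (u ^ n) 0"
  by (simp add: affine_group_def pow_AGL1_restrict)

text \<open>Since \<open>n * (l - 1) + n = l * n\<close>, inverses of powers of \<open>a\<close>
  again have natural exponents.\<close>

lemma power_inverse: "\<exists>m. a ^ m * a ^ n = 1"
proof -
  have "a ^ (n * (l - 1)) * a ^ n = (a ^ l) ^ n"
    using l_pos by (simp add: algebra_simps flip: power_mult power_add)
  then show ?thesis
    using power_l by auto
qed

lemma group_affine_group: "group affine_group"
proof (rule groupI)
  fix f assume "f \<in> carrier affine_group"
  then obtain n c where f: "f = affine_map (a ^ n) c"
    by (auto simp: carrier_affine_group)
  obtain m where "a ^ m * a ^ n = 1"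
    using power_inverse by blast
  then have "affine_map (a ^ m) (- (a ^ m) * c) \<circ> f = id"
    by (simp add: f affine_map_comp flip: affine_map_id)
  then show "\<exists>g\<in>carrier affine_group. g \<otimes>\<^bsub>affine_group\<^esub> f = \<one>\<^bsub>affine_group\<^esub>"
    by (intro bexI[of _ "affine_map (a ^ m) (- (a ^ m) * c)"]) auto
next
  show "\<one>\<^bsub>affine_group\<^esub> \<in> carrier affine_group"
    by (simp flip: affine_map_id)
next
  fix f g assume "f \<in> carrier affine_group" "g \<in> carrier affine_group"
  then obtain n c m e where "f = affine_map (a ^ n) c" "g = affine_map (a ^ m) e"
    by (auto simp: carrier_affine_group)
  then have "f \<otimes>\<^bsub>affine_group\<^esub> g = affine_map (a ^ (n + m)) (a ^ n * e + c)"
    by (simp add: affine_map_comp power_add)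
  then show "f \<otimes>\<^bsub>affine_group\<^esub> g \<in> carrier affine_group"
    by simp
qed (auto simp: comp_assoc)

lemma affine_group_eq:
  "AGL1\<lparr>carrier := translation_subgroup <#>\<^bsub>AGL1\<^esub> generate AGL1 {affine_map a 0}\<rparr> = affine_group"
proof -
  have translation_range: "translation_subgroup = range (affine_map (1 :: 'a))"
    by (auto simp: translation_subgroup_def affine_map_def)
  then have "translation_subgroup <#>\<^bsub>AGL1\<^esub> generate AGL1 {affine_map a 0} =
      {affine_map 1 c \<circ> affine_map (a ^ n) 0 | n c. True}"
    unfolding translation_range set_mult_def generate_AGL1_homothety(1)[OF a_nonzero] by auto
  then show ?thesis
    by (simp add: affine_group_def affine_map_comp)
qed

text \<open>Powers of the product with \<open>w\<close> give all homotheties, because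
  \<open>j\<close> is invertible modulo \<open>l\<close>. Cancelling the linear part of the first
  generator leaves the translation by \<open>c\<close>; conjugation by \<open>h\<close> multiplies
  translation parts by \<open>a\<close>, and \<open>powers_induct\<close> reaches every
  translation.\<close>

lemma generate_affine_group:
  assumes "coprime j l" and "c \<noteq> 0" and "w \<in> carrier affine_group"
    and bw: "affine_map (a ^ i) (a ^ i * c) \<circ> w = affine_map (a ^ j) 0"
  shows "generate affine_group {affine_map (a ^ i) (a ^ i * c), w} = carrier affine_group"
    (is "?K = _")
proof
  interpret group affine_group
    by (rule group_affine_group)
  show "?K \<subseteq> carrier affine_group"
    using assms by (intro generate_incl) auto
  have comp: "f \<circ> g \<in> ?K" if "f \<in> ?K" "g \<in> ?K" for f g
    using generate.eng[OF that] by simp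
  have b: "affine_map (a ^ i) (a ^ i * c) \<in> ?K"
    by (rule generate.incl) simp
  moreover have "w \<in> ?K"
    by (rule generate.incl) simp
  ultimately have j: "affine_map (a ^ j) 0 \<in> ?K"
    using comp bw by metis
  have jm: "affine_map (a ^ (j * m)) 0 \<in> ?K" for m
  proof (induction m)
    case 0
    then show ?case
      using generate.one[of affine_group] by (simp flip: affine_map_id)
  next
    case (Suc m)
    then show ?case
      using comp[OF j Suc] by (simp add: affine_map_comp power_add)
  qed
  obtain m where "[j * m = 1] (mod l)"
    using cong_solve_coprime_nat[OF assms(1)] by auto
  \<comment> \<open>With \<open>m\<close> inverse to \<open>j\<close> modulo \<open>l\<close>, the
    homothety by \<open>a ^ n\<close> is the \<open>m * n\<close>-th power of the one by
    \<open>a ^ j\<close>.\<close>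
  then have "a ^ (j * (m * n)) = a ^ n" for n
    using cong_scalar_right[of "j * m" 1 l n] by (simp add: power_eq_iff mult.assoc)
  then have homothety: "affine_map (a ^ n) 0 \<in> ?K" for n
    using jm[of "m * n"] by simp
  have transl: "affine_map 1 (v * c) \<in> ?K" for v
  proof (induction v rule: powers_induct)
    case 1
    show ?case
      using homothety[of 0] by simp
  next
    case 2
    obtain n where "a ^ n * a ^ i = 1"
      using power_inverse by blast
    then show ?case
      using comp[OF homothety[of n] b] by (simp add: affine_map_comp flip: mult.assoc)
  next
    case (3 u v)
    then show ?case
      using comp[of "affine_map 1 (u * c)" "affine_map 1 (v * c)"]
      by (simp add: affine_map_comp algebra_simps)
  next
    case (4 v)
    obtain n where "a ^ n * a ^ 1 = 1"
      using power_inverse by blast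
    then show ?case
      using comp[OF comp[OF homothety[of 1] 4] homothety[of n]]
      by (simp add: affine_map_comp algebra_simps)
  qed
  show "carrier affine_group \<subseteq> ?K"
  proof
    fix f assume "f \<in> carrier affine_group"
    then obtain n e where f: "f = affine_map (a ^ n) e"
      by (auto simp: carrier_affine_group)
    have "affine_map 1 ((e / c) * c) \<circ> affine_map (a ^ n) 0 \<in> ?K"
      using comp transl homothety by blast
    then show "f \<in> ?K"
      using assms(2) by (simp add: f affine_map_comp)
  qed
qed

text \<open>The \<open>p\<close>-th power has linear part \<open>u ^ p\<close>, and the Frobenius
  map is injective. As translations do have trivial \<open>p\<close>-th power, they are
  characterised by group structure alone.\<close>

lemma linear_part_power_p:
  assumes "affine_map u c [^]\<^bsub>affine_group\<^esub> p = id"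
  shows "u = 1"
proof -
  have "\<exists>e. affine_map u c [^]\<^bsub>affine_group\<^esub> n = affine_map (u ^ n) e" for n :: nat
  proof (induction n)
    case 0
    show ?case
      by (auto simp flip: affine_map_id)
  next
    case (Suc n)
    then obtain e where "affine_map u c [^]\<^bsub>affine_group\<^esub> n = affine_map (u ^ n) e"
      by blast
    then have "affine_map u c [^]\<^bsub>affine_group\<^esub> Suc n = affine_map (u ^ Suc n) (u ^ n * c + e)"
      by (simp add: affine_map_comp mult.commute)
    then show ?case
      by blast
  qed
  then have "u ^ p = 1"
    using assms affine_map_eq_iff by (metis affine_map_id)
  then show ?thesis
    using frobenius_inj[of u 1 1] by simp
qed

text \<open>The translation part \<open>e\<close> is left open: the exponents \<open>i\<close> and
  \<open>j\<close> are visible in the linear parts alone.\<close>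

lemma iso_linear_part:
  assumes \<theta>: "\<theta> \<in> iso affine_group affine_group"
  shows "\<exists>k<d. \<forall>n c. \<exists>e. \<theta> (affine_map (a ^ n) c) = affine_map (a ^ (p ^ k * n)) e"
proof -
  interpret group affine_group
    by (rule group_affine_group)
  interpret \<theta>: group_hom affine_group affine_group \<theta>
    using \<theta> by (auto simp: group_hom_def group_hom_axioms_def iso_def group_affine_group)
  have \<theta>_comp: "\<theta> (f \<circ> g) = \<theta> f \<circ> \<theta> g" if "f \<in> carrier affine_group" "g \<in> carrier affine_group" for f g
    using \<theta>.hom_mult[OF that] by simp
  have \<theta>_affine: "\<exists>m e. \<theta> f = affine_map (a ^ m) e" if "f \<in> carrier affine_group" for f
    using \<theta>.hom_closed[OF that] by (auto simp: carrier_affine_group)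
  have "\<exists>e. \<theta> (affine_map 1 c) = affine_map 1 e" for c
  proof -
    have "affine_map 1 c [^]\<^bsub>affine_group\<^esub> n = affine_map 1 (of_nat n * c)" for n :: nat
      by (induction n) (auto simp: affine_map_comp algebra_simps simp flip: affine_map_id)
    then have "affine_map 1 c [^]\<^bsub>affine_group\<^esub> p = id"
      using of_nat_CHAR[where ?'a = 'a] by (simp add: char_eq affine_map_id)
    then have "\<theta> (affine_map 1 c) [^]\<^bsub>affine_group\<^esub> p = id"
      using \<theta>.hom_nat_pow[of "affine_map 1 c" p] \<theta>.hom_one by simp
    moreover obtain m e where "\<theta> (affine_map 1 c) = affine_map (a ^ m) e"
      using \<theta>_affine[of "affine_map 1 c"] by auto
    ultimately show ?thesis
      using linear_part_power_p by metis
  qed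
  then obtain T where T: "\<And>c. \<theta> (affine_map 1 c) = affine_map 1 (T c)"
    by metis
  have T_add: "T (c + e) = T c + T e" for c e
  proof -
    have "affine_map 1 (T (c + e)) = \<theta> (affine_map 1 c \<circ> affine_map 1 e)"
      by (simp add: affine_map_comp T add.commute)
    also have "\<dots> = affine_map 1 (T c + T e)"
      by (subst \<theta>_comp) (auto simp: T affine_map_comp add.commute)
    finally show ?thesis
      by (simp add: affine_map_eq_iff)
  qed
  have "T 1 \<noteq> 0"
  proof
    assume "T 1 = 0"
    then have "T 0 = T 1"
      using T_add[of 0 0] by (metis add.right_neutral add_left_cancel)
    then have "\<theta> (affine_map 1 0) = \<theta> (affine_map 1 1)"
      by (simp add: T)
    then have "affine_map 1 0 = (affine_map 1 1 :: 'a \<Rightarrow> 'a)"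
      using \<theta> by (auto simp: iso_def bij_betw_def dest!: inj_onD)
    then show False
      by (simp add: affine_map_eq_iff)
  qed
  obtain m r where h: "\<theta> (affine_map a 0) = affine_map (a ^ m) r"
    using \<theta>_affine affine_map_in_affine_group[of 1] by fastforce
  have "T (a * c) = a ^ m * T c" for c
  proof -
    \<comment> \<open>The image under \<open>\<theta>\<close> of the relation "\<open>h\<close>
      after translation by \<open>c\<close> equals translation by \<open>a * c\<close> after
      \<open>h\<close>"; comparing translation parts cancels \<open>r\<close>.\<close>
    have "affine_map (a ^ m) r \<circ> affine_map 1 (T c) = \<theta> (affine_map a 0 \<circ> affine_map 1 c)"
      using affine_map_in_affine_group[of 1 0] by (subst \<theta>_comp) (auto simp: T h)
    also have "\<dots> = \<theta> (affine_map 1 (a * c) \<circ> affine_map a 0)"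
      by (simp add: affine_map_comp)
    also have "\<dots> = affine_map 1 (T (a * c)) \<circ> affine_map (a ^ m) r"
      using affine_map_in_affine_group[of 1 0] by (subst \<theta>_comp) (auto simp: T h)
    finally show ?thesis
      by (simp add: affine_map_comp affine_map_eq_iff)
  qed
  then obtain k where k: "k < d" "a ^ m = a ^ p ^ k"
    using semilinear_eigenvalue[of T "a ^ m"] T_add \<open>T 1 \<noteq> 0\<close> by blast
  have "\<exists>e. \<theta> (affine_map (a ^ n) 0) = affine_map (a ^ (p ^ k * n)) e" for n
  proof (induction n)
    case 0
    then show ?case
      using T[of 0] by (auto simp: affine_map_eq_iff)
  next
    case (Suc n)
    then obtain e where "\<theta> (affine_map (a ^ n) 0) = affine_map (a ^ (p ^ k * n)) e"
      by blast
    moreover have "affine_map (a ^ Suc n) 0 = affine_map a 0 \<circ> affine_map (a ^ n) 0"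
      by (simp add: affine_map_comp)
    moreover have "\<theta> (affine_map a 0 \<circ> affine_map (a ^ n) 0) =
        \<theta> (affine_map a 0) \<circ> \<theta> (affine_map (a ^ n) 0)"
      using affine_map_in_affine_group[of 1 0] by (intro \<theta>_comp) auto
    ultimately show ?case
      by (auto simp: h k affine_map_comp power_add)
  qed
  \<comment> \<open>A translation applied last leaves the linear part unchanged, so the case
    \<open>c = 0\<close> suffices.\<close>
  moreover have "\<theta> (affine_map (a ^ n) c) = affine_map 1 (T c) \<circ> \<theta> (affine_map (a ^ n) 0)" for n c
  proof -
    have "affine_map (a ^ n) c = affine_map 1 c \<circ> affine_map (a ^ n) 0"
      by (simp add: affine_map_comp)
    then show ?thesis
      using \<theta>_comp[of "affine_map 1 c" "affine_map (a ^ n) 0"] by (simp add: T)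
  qed
  ultimately have "\<exists>e. \<theta> (affine_map (a ^ n) c) = affine_map (a ^ (p ^ k * n)) e" for n c
    by (metis affine_map_comp mult_1)
  then show ?thesis
    using k(1) by blast
qed

text \<open>The automorphism is conjugation by the bijection sending \<open>z\<close> to
  \<open>m * z ^ p ^ k\<close>. On the finite carrier injectivity already gives
  surjectivity.\<close>

lemma frobenius_iso:
  assumes "m \<noteq> 0"
  shows "\<exists>\<theta>\<in>iso affine_group affine_group.
    \<forall>n c. \<theta> (affine_map (a ^ n) c) = affine_map (a ^ (n * p ^ k)) (m * c ^ p ^ k)"
proof
  \<comment> \<open>The values at \<open>0\<close> and \<open>1\<close> recover both coordinates of
    an affine map, so no exponent \<open>n\<close>, unique only modulo \<open>l\<close>, has to be
    chosen.\<close>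
  define \<theta> where "\<theta> f = affine_map ((f 1 - f 0) ^ p ^ k) (m * f 0 ^ p ^ k)" for f :: "'a \<Rightarrow> 'a"
  have \<theta>_affine: "\<theta> (affine_map u c) = affine_map (u ^ p ^ k) (m * c ^ p ^ k)" for u c
    by (simp add: \<theta>_def affine_map_def)
  then show \<theta>: "\<forall>n c. \<theta> (affine_map (a ^ n) c) = affine_map (a ^ (n * p ^ k)) (m * c ^ p ^ k)"
    by (simp add: power_mult)
  then have closed: "\<theta> f \<in> carrier affine_group" if "f \<in> carrier affine_group" for f
    using that by (auto simp: carrier_affine_group)
  have "\<theta> \<in> hom affine_group affine_group"
    using closed
    by (auto intro!: homI simp: carrier_affine_group affine_map_comp \<theta>_affine affine_map_eq_iff
        frobenius_add power_mult_distrib algebra_simps)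
  moreover have "inj_on \<theta> (carrier affine_group)"
    using assms
    by (auto intro!: inj_onI simp: carrier_affine_group \<theta>_affine affine_map_eq_iff
        dest!: frobenius_inj)
  moreover from this have "\<theta> ` carrier affine_group = carrier affine_group"
    using closed by (intro endo_inj_surj) auto
  ultimately show "\<theta> \<in> iso affine_group affine_group"
    by (simp add: iso_def bij_betw_def)
qed

end

theorem mainTheorem8:
  fixes p d l i1 i2 j1 j2 :: nat
    and h x1 x2 b1 b2 w1 w2 :: "'a::{finite,field} \<Rightarrow> 'a"
    and N H :: "('a \<Rightarrow> 'a) set"
    and G :: "('a \<Rightarrow> 'a) monoid"
  assumes "prime p" and "d \<ge> 1" and "primitive_divisor l p d"
    and "CARD('a) = p ^ d"
    and "N = translation_subgroup"
    and "h \<in> GL1" and "H = generate AGL1 {h}" and "card H = l"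
    and "G = AGL1\<lparr>carrier := N <#>\<^bsub>AGL1\<^esub> H\<rparr>"
    and "x1 \<in> N - {\<one>\<^bsub>G\<^esub>}" and "x2 \<in> N - {\<one>\<^bsub>G\<^esub>}"
    and "i1 \<le> l - 1" and "i2 \<le> l - 1" and "j1 \<le> l - 1" and "j2 \<le> l - 1"
    and "gcd j1 l = 1" and "gcd j2 l = 1"
    and "b1 = h [^]\<^bsub>G\<^esub> i1 \<otimes>\<^bsub>G\<^esub> x1"
    and "w1 = inv\<^bsub>G\<^esub> x1 \<otimes>\<^bsub>G\<^esub> h [^]\<^bsub>G\<^esub> (int j1 - int i1)"
    and "b2 = h [^]\<^bsub>G\<^esub> i2 \<otimes>\<^bsub>G\<^esub> x2"
    and "w2 = inv\<^bsub>G\<^esub> x2 \<otimes>\<^bsub>G\<^esub> h [^]\<^bsub>G\<^esub> (int j2 - int i2)"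
  shows "dessin_isomorphic (regular_dessin G b1 w1) (regular_dessin G b2 w2) \<longleftrightarrow>
         (\<exists>k. 0 \<le> k \<and> k \<le> d - 1 \<and>
              [i2 = i1 * p ^ k] (mod l) \<and> [j2 = j1 * p ^ k] (mod l))"
proof -
  obtain a where a: "a \<noteq> 0" "h = affine_map a 0"
    using assms(6) by (auto simp: GL1_def affine_map_def)
  interpret primitive_field_element p d l a
    using assms(1-4,7,8) generate_AGL1_homothety(2)[OF a(1)]
    by unfold_locales (auto simp: a(2))
  have G: "G = affine_group"
    using assms(5,7,9) affine_group_eq a(2) by simp
  interpret group G
    unfolding G by (rule group_affine_group)
  have h: "h \<in> carrier G"
    using affine_map_in_affine_group[of 1 0] by (simp add: G a(2))
  have translation: "\<exists>c. c \<noteq> 0 \<and> x = affine_map 1 c" if x: "x \<in> N - {\<one>\<^bsub>G\<^esub>}" for x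
  proof -
    obtain c where c: "x = affine_map 1 c"
      using x by (auto simp: assms(5) translation_subgroup_def affine_map_def)
    moreover have "x \<noteq> affine_map 1 0"
      using x by (simp add: G affine_map_id)
    ultimately show ?thesis
      by (auto simp: affine_map_eq_iff)
  qed
  obtain c1 where c1: "c1 \<noteq> 0" "x1 = affine_map 1 c1"
    using translation assms(10) by blast
  obtain c2 where c2: "c2 \<noteq> 0" "x2 = affine_map 1 c2"
    using translation assms(11) by blast
  have x: "x1 \<in> carrier G" "x2 \<in> carrier G"
    by (simp_all add: G c1 c2)
  have b1: "b1 = affine_map (a ^ i1) (a ^ i1 * c1)" and b2: "b2 = affine_map (a ^ i2) (a ^ i2 * c2)"
    by (simp_all add: assms(18,20) G a(2) pow_affine_group c1 c2 affine_map_comp)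
  have b: "b1 \<in> carrier G" "b2 \<in> carrier G"
    by (simp_all add: G b1 b2)
  have w: "w1 \<in> carrier G" "w2 \<in> carrier G"
    using h x by (simp_all add: assms(19,21))
  \<comment> \<open>In the product of the two generators \<open>x\<close> cancels. The exponent
    \<open>j - i\<close> may be negative, so the remaining powers of \<open>h\<close> are added over
    the integers.\<close>
  have face: "(h [^]\<^bsub>G\<^esub> i \<otimes>\<^bsub>G\<^esub> x) \<otimes>\<^bsub>G\<^esub> (inv\<^bsub>G\<^esub> x \<otimes>\<^bsub>G\<^esub> h [^]\<^bsub>G\<^esub> (int j - int i)) = affine_map (a ^ j) 0"
    if "x \<in> carrier G" for x i j
  proof -
    have "(h [^]\<^bsub>G\<^esub> i \<otimes>\<^bsub>G\<^esub> x) \<otimes>\<^bsub>G\<^esub> (inv\<^bsub>G\<^esub> x \<otimes>\<^bsub>G\<^esub> h [^]\<^bsub>G\<^esub> (int j - int i)) =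
        h [^]\<^bsub>G\<^esub> i \<otimes>\<^bsub>G\<^esub> h [^]\<^bsub>G\<^esub> (int j - int i)"
      using that h by (simp add: inv_solve_left m_assoc flip: m_assoc[of x])
    also have "\<dots> = h [^]\<^bsub>G\<^esub> (int i + (int j - int i))"
      using h by (simp only: int_pow_mult int_pow_int)
    also have "\<dots> = h [^]\<^bsub>G\<^esub> j"
      by (simp add: int_pow_int)
    also have "\<dots> = affine_map (a ^ j) 0"
      by (simp add: G a(2) pow_affine_group)
    finally show ?thesis .
  qed
  have face1: "b1 \<otimes>\<^bsub>G\<^esub> w1 = affine_map (a ^ j1) 0" and face2: "b2 \<otimes>\<^bsub>G\<^esub> w2 = affine_map (a ^ j2) 0"
    using face[OF x(1)] face[OF x(2)] by (simp_all only: assms(18-21))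
  have gen: "generate G {b1, w1} = carrier G"
    unfolding G b1
  proof (rule generate_affine_group)
    show "coprime j1 l"
      using assms(16) by (simp add: coprime_iff_gcd_eq_1)
    show "w1 \<in> carrier affine_group"
      using w G by simp
    show "affine_map (a ^ i1) (a ^ i1 * c1) \<circ> w1 = affine_map (a ^ j1) 0"
      using face1 by (simp add: G b1)
  qed (rule c1)
  show ?thesis
  proof
    assume "dessin_isomorphic (regular_dessin G b1 w1) (regular_dessin G b2 w2)"
    then obtain \<theta> where \<theta>: "\<theta> \<in> iso G G" "\<theta> b1 = b2" "\<theta> w1 = w2"
      using dessin_isomorphic_imp_iso[OF is_group is_group b w gen] by blast
    then obtain k where k: "k < d"
      "\<And>n c. \<exists>e. \<theta> (affine_map (a ^ n) c) = affine_map (a ^ (p ^ k * n)) e"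
      using iso_linear_part unfolding G by blast
    have "\<theta> (b1 \<otimes>\<^bsub>G\<^esub> w1) = b2 \<otimes>\<^bsub>G\<^esub> w2"
      using \<theta> b w by (auto simp: iso_def hom_def)
    then have "a ^ j2 = a ^ (p ^ k * j1)"
      using k(2)[of j1 0] unfolding face1 face2 by (auto simp: affine_map_eq_iff)
    moreover have "a ^ i2 = a ^ (p ^ k * i1)"
      using k(2)[of i1 "a ^ i1 * c1"] \<theta>(2) unfolding b1 b2 by (auto simp: affine_map_eq_iff)
    ultimately show "\<exists>k. 0 \<le> k \<and> k \<le> d - 1 \<and>
        [i2 = i1 * p ^ k] (mod l) \<and> [j2 = j1 * p ^ k] (mod l)"
      using k(1) by (intro exI[of _ k]) (auto simp: power_eq_iff mult.commute)
  next
    assume "\<exists>k. 0 \<le> k \<and> k \<le> d - 1 \<and>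
        [i2 = i1 * p ^ k] (mod l) \<and> [j2 = j1 * p ^ k] (mod l)"
    then obtain k where k: "a ^ i2 = a ^ (i1 * p ^ k)" "a ^ j2 = a ^ (j1 * p ^ k)"
      by (auto simp: power_eq_iff)
    \<comment> \<open>This scalar makes \<open>m * c1 ^ p ^ k = c2\<close>, so that
      \<open>x1\<close> is sent to \<open>x2\<close> and, by the congruence for \<open>i2\<close>,
      \<open>b1\<close> to \<open>b2\<close>.\<close>
    define m where "m = c2 / c1 ^ p ^ k"
    have "m \<noteq> 0"
      by (simp add: m_def c1 c2)
    then obtain \<theta> where \<theta>: "\<theta> \<in> iso G G"
      "\<And>n c. \<theta> (affine_map (a ^ n) c) = affine_map (a ^ (n * p ^ k)) (m * c ^ p ^ k)"
      using frobenius_iso[of m k] unfolding G by blast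
    have \<theta>_b: "\<theta> b1 = b2"
      using c1(1)
      by (simp add: b1 b2 \<theta>(2) k affine_map_eq_iff m_def power_mult_distrib flip: power_mult)
    \<comment> \<open>The coordinates of \<open>w1\<close> and \<open>w2\<close> are not computed:
      both products with \<open>b2\<close> are the homothety by \<open>a ^ j2\<close>, and
      \<open>b2\<close> is cancelled.\<close>
    have "b2 \<otimes>\<^bsub>G\<^esub> \<theta> w1 = \<theta> (b1 \<otimes>\<^bsub>G\<^esub> w1)"
      using \<theta>(1) b w by (auto simp: iso_def hom_def \<theta>_b)
    also have "\<dots> = b2 \<otimes>\<^bsub>G\<^esub> w2"
      using prime_gt_0_nat[OF prime_p] by (simp add: face1 face2 \<theta>(2) k power_0_left)
    finally have "b2 \<otimes>\<^bsub>G\<^esub> \<theta> w1 = b2 \<otimes>\<^bsub>G\<^esub> w2" .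
    moreover have "\<theta> w1 \<in> carrier G"
      using \<theta>(1) w by (auto simp: iso_def hom_def)
    ultimately have "\<theta> w1 = w2"
      using b w by simp
    then show "dessin_isomorphic (regular_dessin G b1 w1) (regular_dessin G b2 w2)"
      using iso_imp_dessin_isomorphic[OF is_group is_group \<theta>(1) b(1) w(1)] \<theta>_b by simp
  qed
qed

end
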